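(* Let $p$ be any prime number and let $A=\mathbb{Z}\{X,Y\}$. Then there is no map of sets $\rho: HH_0(E(A))\to W(A)$ which commutes with the ghost maps $\overline{\eta}: HH_0(E(A))\to (A/[A,A])^{\mathbb{N}_0}$ and $\overline{\omega}: W(A)\to (A/[A,A])^{\mathbb{N}_0}$, i.e. such that $\overline{\omega}\circ\rho=\overline{\eta}$.
   Context: $\mathbb{N}_0=\{0,1,2,\dots\}$. $\mathbb{Z}\{X,Y\}$ is the free unital associative (non-commutative) polynomial ring over $\mathbb{Z}$ on two generators. For a ring $B$, $[B,B]$ denotes the additive subgroup generated by all $xy-yx$ with $x,y\in B$. Hesselholt's group $W(A)$. For $n\ge 1$ let $\omega: A^{n}\to (A/[A,A])^{n}$ be the map of sets with components, for $0\le i\le n-1$, the classes of $\omega_i(a_0,\dots,a_i)=a_0^{p^i}+pa_1^{p^{i-1}}+\cdots+p^ia_i$; define $\omega:A^{\mathbb{N}_0}\to(A/[A,A])^{\mathbb{N}_0}$ by the same formulas for all $i\ge 0$. Hesselholt constructs abelian groups $W_n(A)$ and a factorization $A^n\xrightarrow{q_n}W_n(A)\xrightarrow{\overline\omega}(A/[A,A])^n$ of $\omega$ with $q_n$ a surjective map of sets and $\overline\omega$ an additive homomorphism that is injective when $A/[A,A]$ is $p$-torsion free. For $A=\mathbb{Z}\{X,Y\}$ the group $A/[A,A]$ is torsion free, so $W_n(A)$ is identified with the image of $\omega$ in $(A/[A,A])^n$ (which is a subgroup). $W(A)=\varprojlim_n W_n(A)$ along the truncation maps. There is a surjective map $q:A^{\mathbb{N}_0}\to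 W(A)$ and a homomorphism, the ghost map, $\overline\omega:W(A)\to(A/[A,A])^{\mathbb{N}_0}$ with $\overline\omega\circ q=\omega$. Cuntz–Deninger's ring $E(A)$. For a ring $B$, give $B^{\mathbb{N}_0}$ the componentwise ring structure and the product topology with $B$ discrete. Put $V(b_0,b_1,\dots)=p(0,b_0,b_1,\dots)$ and $\langle b\rangle=(b,b^p,b^{p^2},\dots)$. For $B$ itself or a two-sided ideal $I\subset B$ let $X(B)$, respectively $X(I)$, be the closed additive subgroup of $B^{\mathbb{N}_0}$ generated by all $V^m(\langle b_1\rangle\cdots\langle b_r\rangle)$ with $m\in\mathbb{N}_0$, $r\ge1$ and all $b_i\in B$, respectively all $b_i\in I$. $X(B)$ is a ring and $X(I)$ is an ideal of it. Let $\mathbb{Z}A$ be the monoid algebra of the multiplicative monoid of $A$ (formal finite sums $\sum n_r[r]$, $r\in A$), and let $I$ be the kernel of the ring epimorphism $\mathbb{Z}A\to A$, $[r]\mapsto r$. Then $E(A)=X(\mathbb{Z}A)/X(I)$, a Hausdorff topological ring with the quotient topology. $HH_0(E(A))=E(A)/\overline{[E(A),E(A)]}$ is the quotient by the closure of the additive subgroup generated by commutators. The ghost map $\overline\eta$. The epimorphism $\mathbb{Z}A\to A$ induces, componentwise, a ring homomorphism $\pi:E(A)\to X(A)$. Let $\gamma: X(A)\hookrightarrow A^{\mathbb{N}_0}\to(A/[A,A])^{\mathbb{N}_0}$ be the inclusion followed by the componentwise quotient map, and $\eta=\gamma\circ\pi$. The map $\eta$ vanishes on $\overline{[E(A),E(A)]}$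 and so induces a group homomorphism $\overline\eta: HH_0(E(A))\to(A/[A,A])^{\mathbb{N}_0}$. *)

theory Defs
  imports
    "HOL-Analysis.Analysis"
    "HOL-Algebra.Algebra"
    "HOL-Algebra.Algebraic_Closure_Type"
    "HOL-Library.Poly_Mapping"
    "HOL-Library.Function_Algebras"
begin

text \<open>
  The product of \<^typ>\<open>'k \<Rightarrow>\<^sub>0 int\<close> is convolution with respect to the addition of \<open>'k\<close>.
  Hence the monoid algebra of a multiplicative monoid is \<open>'k \<Rightarrow>\<^sub>0 int\<close>, where \<open>'k\<close> is a copy of that
  monoid written additively (and not necessarily commutative).
\<close>

datatype 'x free_mon = Word (letters: "'x list")

instantiation free_mon :: (type) monoid_add
begin

definition zero_free_mon :: "'x free_mon" where
  "zero_free_mon = Word []"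

definition plus_free_mon :: "'x free_mon \<Rightarrow> 'x free_mon \<Rightarrow> 'x free_mon" where
  "plus_free_mon u v = Word (letters u @ letters v)"

instance
  by standard (simp_all add: zero_free_mon_def plus_free_mon_def)

end

datatype letter = LX | LY

text \<open>The free ring \<open>\<int>{X,Y}\<close>; the generators are \<open>Poly_Mapping.single (Word [LX]) 1\<close> and
  \<open>Poly_Mapping.single (Word [LY]) 1\<close>.\<close>

type_synonym ZXY = "letter free_mon \<Rightarrow>\<^sub>0 int"

datatype 'a mult_mon = Mult (unMult: 'a)

instantiation mult_mon :: (monoid_mult) monoid_add
begin

definition zero_mult_mon :: "'a mult_mon" where
  "zero_mult_mon = Mult 1"

definition plus_mult_mon :: "'a mult_mon \<Rightarrow> 'a mult_mon \<Rightarrow> 'a mult_mon" where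
  "plus_mult_mon u v = Mult (unMult u * unMult v)"

instance
  by standard (simp_all add: zero_mult_mon_def plus_mult_mon_def mult.assoc)

end

text \<open>The monoid algebra \<open>\<int>A\<close> of the whole multiplicative monoid of \<open>A\<close>; in particular \<open>[0]\<close> is a
  basis element and not the zero of \<open>\<int>A\<close>.\<close>

type_synonym 'a mon_alg = "'a mult_mon \<Rightarrow>\<^sub>0 int"

definition aug :: "'a::ring_1 mon_alg \<Rightarrow> 'a" where
  "aug s = (\<Sum>r\<in>Poly_Mapping.keys s. of_int (Poly_Mapping.lookup s r) * unMult r)"

definition aug_ideal :: "'a::ring_1 mon_alg set" where
  "aug_ideal = {s. aug s = 0}"


section \<open>Commutator quotients\<close>

definition comm_subgroup :: "('a, 'm) ring_scheme \<Rightarrow> 'a set" where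
  "comm_subgroup R =
     generate (add_monoid R)
       {x \<otimes>\<^bsub>R\<^esub> y \<ominus>\<^bsub>R\<^esub> y \<otimes>\<^bsub>R\<^esub> x | x y. x \<in> carrier R \<and> y \<in> carrier R}"

text \<open>\<open>A/[A,A]\<close> for a ring \<open>A\<close> given as a type; its elements are cosets.\<close>

definition ab_quot :: "'a::ring_1 set monoid" where
  "ab_quot = add_monoid ring_of_type_algebra Mod comm_subgroup ring_of_type_algebra"

definition ab_class :: "'a::ring_1 \<Rightarrow> 'a set" where
  "ab_class a = comm_subgroup ring_of_type_algebra +>\<^bsub>ring_of_type_algebra\<^esub> a"


section \<open>Hesselholt's group\<close>

definition witt_poly :: "nat \<Rightarrow> nat \<Rightarrow> (nat \<Rightarrow> 'a::ring_1) \<Rightarrow> 'a" where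
  "witt_poly p i a = (\<Sum>j\<le>i. of_nat p ^ j * a j ^ (p ^ (i - j)))"

definition omega :: "nat \<Rightarrow> nat \<Rightarrow> (nat \<Rightarrow> 'a::ring_1) \<Rightarrow> nat \<Rightarrow> 'a set" where
  "omega p n a = (\<lambda>i\<in>{..<n}. ab_class (witt_poly p i a))"

text \<open>\<open>W\<^sub>n(A)\<close>, realised as the image of \<open>\<omega>\<close> in \<open>(A/[A,A])\<^sup>n\<close>; here \<open>\<omega>\<close> itself plays the role of
  \<open>q\<^sub>n\<close>, and the ghost map of \<open>W\<^sub>n(A)\<close> is the inclusion. This is Hesselholt's group only when
  \<open>A/[A,A]\<close> has no \<open>p\<close>-torsion, as is the case for \<open>\<int>{X,Y}\<close>.\<close>

definition W_trunc :: "nat \<Rightarrow> nat \<Rightarrow> (nat \<Rightarrow> 'a::ring_1 set) monoid" where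
  "W_trunc p n =
     (product_group {..<n} (\<lambda>_. ab_quot))
       \<lparr>carrier := omega p n ` ({..<n} \<rightarrow>\<^sub>E (UNIV :: 'a set))\<rparr>"

text \<open>The inverse limit of the \<open>W\<^sub>n(A)\<close>, \<open>n \<ge> 1\<close>, along truncation.\<close>

definition W_group :: "nat \<Rightarrow> (nat \<Rightarrow> nat \<Rightarrow> 'a::ring_1 set) monoid" where
  "W_group p =
     (product_group {1..} (W_trunc p))
       \<lparr>carrier := {w \<in> (\<Pi>\<^sub>E n\<in>{1..}. carrier (W_trunc p n)).
          \<forall>n\<ge>1. restrict (w (Suc n)) {..<n} = w n}\<rparr>"

text \<open>The ghost component of index \<open>i\<close> is read off in \<open>W\<^sub>i\<^sub>+\<^sub>1(A)\<close>, the first group in which it occurs.\<close>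

definition omega_bar :: "(nat \<Rightarrow> nat \<Rightarrow> 'a set) \<Rightarrow> nat \<Rightarrow> 'a set" where
  "omega_bar w = (\<lambda>i. w (Suc i) i)"


section \<open>The ring of Cuntz and Deninger\<close>

definition seq_top :: "(nat \<Rightarrow> 'b) topology" where
  "seq_top = product_topology (\<lambda>_. discrete_topology UNIV) UNIV"

definition versch :: "nat \<Rightarrow> (nat \<Rightarrow> 'b::ring_1) \<Rightarrow> nat \<Rightarrow> 'b" where
  "versch p b = (\<lambda>n. case n of 0 \<Rightarrow> 0 | Suc k \<Rightarrow> of_nat p * b k)"

definition teich :: "nat \<Rightarrow> 'b::ring_1 \<Rightarrow> nat \<Rightarrow> 'b" where
  "teich p b = (\<lambda>n. b ^ (p ^ n))"

definition X_gens :: "nat \<Rightarrow> 'b::ring_1 set \<Rightarrow> (nat \<Rightarrow> 'b) set" where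
  "X_gens p S =
     {(versch p ^^ m) (prod_list (map (teich p) bs)) | m bs. bs \<noteq> [] \<and> set bs \<subseteq> S}"

text \<open>\<open>X(B)\<close> is \<open>X_set p UNIV\<close>, and \<open>X(I)\<close> is \<open>X_set p I\<close>.\<close>

definition X_set :: "nat \<Rightarrow> 'b::ring_1 set \<Rightarrow> (nat \<Rightarrow> 'b) set" where
  "X_set p S =
     \<Inter> {H. additive_subgroup H ring_of_type_algebra \<and> closedin seq_top H \<and> X_gens p S \<subseteq> H}"

definition X_ring :: "nat \<Rightarrow> (nat \<Rightarrow> 'b::ring_1) ring" where
  "X_ring p = ring_of_type_algebra \<lparr>carrier := X_set p UNIV\<rparr>"

definition E_ring :: "nat \<Rightarrow> (nat \<Rightarrow> 'a::ring_1 mon_alg) set ring" where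
  "E_ring p = X_ring p Quot X_set p aug_ideal"

definition E_class :: "nat \<Rightarrow> (nat \<Rightarrow> 'a::ring_1 mon_alg) \<Rightarrow> (nat \<Rightarrow> 'a mon_alg) set" where
  "E_class p f = X_set p aug_ideal +>\<^bsub>X_ring p\<^esub> f"

text \<open>The quotient topology with respect to \<open>E_class p : X(\<int>A) \<rightarrow> E(A)\<close>.\<close>

definition E_top :: "nat \<Rightarrow> (nat \<Rightarrow> 'a::ring_1 mon_alg) set topology" where
  "E_top p = topology (\<lambda>U. U \<subseteq> carrier (E_ring p) \<and>
     openin (subtopology seq_top (X_set p UNIV)) {f \<in> X_set p UNIV. E_class p f \<in> U})"

lemma openin_E_top:
  fixes U :: "(nat \<Rightarrow> 'a::ring_1 mon_alg) set set"
  shows "openin (E_top p) U \<longleftrightarrow> U \<subseteq> carrier (E_ring p) \<and>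
     openin (subtopology seq_top (X_set p UNIV)) {f \<in> X_set p UNIV. E_class p f \<in> U}"
proof -
  have "istopology (\<lambda>U :: (nat \<Rightarrow> 'a mon_alg) set set. U \<subseteq> carrier (E_ring p) \<and>
     openin (subtopology seq_top (X_set p UNIV)) {f \<in> X_set p UNIV. E_class p f \<in> U})"
    (is "istopology ?P")
    unfolding istopology_def
  proof (intro conjI allI impI)
    fix S T assume "?P S" "?P T"
    moreover have "{f \<in> X_set p UNIV. E_class p f \<in> S \<inter> T} =
        {f \<in> X_set p UNIV. E_class p f \<in> S} \<inter> {f \<in> X_set p UNIV. E_class p f \<in> T}"
      by blast
    ultimately show "S \<inter> T \<subseteq> carrier (E_ring p)"
      and "openin (subtopology seq_top (X_set p UNIV)) {f \<in> X_set p UNIV. E_class p f \<in> S \<inter> T}"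
      by (auto simp only: intro: openin_Int)
  next
    fix \<K> assume K: "\<forall>K\<in>\<K>. ?P K"
    then show "\<Union>\<K> \<subseteq> carrier (E_ring p)" by blast
    have "{f \<in> X_set p UNIV. E_class p f \<in> \<Union>\<K>} =
        (\<Union>K\<in>\<K>. {f \<in> X_set p UNIV. E_class p f \<in> K})"
      by blast
    then show "openin (subtopology seq_top (X_set p UNIV)) {f \<in> X_set p UNIV. E_class p f \<in> \<Union>\<K>}"
      using K by (metis (no_types, lifting) openin_Union imageE)
  qed
  then show ?thesis
    by (simp add: E_top_def topology_inverse')
qed

text \<open>
  \<open>[E(A),E(A)]\<close>: the commutator of the classes of \<open>f\<close> and \<open>g\<close> is the class of \<open>f g - g f\<close>. It is
  written with representatives because \<^const>\<open>rcoset_mult\<close> yields cosets only when \<open>X(I)\<close> is an ideal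
  of \<open>X(\<int>A)\<close>. As long as \<open>X(I)\<close> requires all \<open>b\<^sub>i\<close> to lie in \<open>I\<close>, this may fail for noncommutative
  \<open>A\<close>, since \<open>\<langle>b\<rangle>\<langle>c\<rangle>\<close> is in general different from \<open>\<langle>b c\<rangle>\<close>. If \<open>X(I)\<close> is an ideal, this is the
  additive commutator subgroup of the ring \<open>E(A)\<close>.
\<close>

definition E_comm :: "nat \<Rightarrow> (nat \<Rightarrow> 'a::ring_1 mon_alg) set set" where
  "E_comm p =
     generate (add_monoid (E_ring p))
       {E_class p (f * g - g * f) | f g. f \<in> X_set p UNIV \<and> g \<in> X_set p UNIV}"

definition HH0_E :: "nat \<Rightarrow> (nat \<Rightarrow> 'a::ring_1 mon_alg) set set monoid" where
  "HH0_E p = add_monoid (E_ring p) Mod (E_top p closure_of E_comm p)"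

text \<open>Maps induced on a quotient are written as in \<open>FactGroup_hom\<close>: \<open>the_elem\<close> extracts the common
  value taken on a coset.\<close>

definition pi_E :: "(nat \<Rightarrow> 'a::ring_1 mon_alg) set \<Rightarrow> nat \<Rightarrow> 'a" where
  "pi_E c = the_elem ((\<lambda>f n. aug (f n)) ` c)"

definition gamma :: "(nat \<Rightarrow> 'a::ring_1) \<Rightarrow> nat \<Rightarrow> 'a set" where
  "gamma f = (\<lambda>n. ab_class (f n))"

definition eta :: "(nat \<Rightarrow> 'a::ring_1 mon_alg) set \<Rightarrow> nat \<Rightarrow> 'a set" where
  "eta c = gamma (pi_E c)"

definition eta_bar :: "(nat \<Rightarrow> 'a::ring_1 mon_alg) set set \<Rightarrow> nat \<Rightarrow> 'a set" where
  "eta_bar h = the_elem (eta ` h)"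

end

theory Submission
  imports Defs
begin

text \<open>
  The element \<open>\<langle>[X]\<rangle>\<langle>[Y]\<rangle>\<close> of \<open>X(\<int>A)\<close> has ghost components \<open>X\<^sup>q Y\<^sup>q\<close>, where \<open>q\<close> runs through the powers
  of \<open>p\<close>; the component of index 1 already is not of the form \<open>a\<^sub>0\<^sup>p + p a\<^sub>1\<close> in \<open>A/[A,A]\<close>. Indeed,
  the sum of the coefficients of all rotations of the word \<open>X\<^sup>p Y\<^sup>p\<close> is a trace \<open>T\<close> on \<open>A\<close>. Expanding
  \<open>a\<^sup>p\<close> and letting the cyclic group of order \<open>p\<close> rotate the factors gives
  \<open>T(a\<^sup>p) \<equiv> \<Sum> T((c\<^sub>w w)\<^sup>p)\<close> modulo \<open>p\<close>, summed over the terms \<open>c\<^sub>w w\<close> of \<open>a\<close>. This vanishes because no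
  \<open>w\<^sup>p\<close> is a rotation of \<open>X\<^sup>p Y\<^sup>p\<close>, whereas \<open>T(X\<^sup>p Y\<^sup>p) = 1\<close>.
\<close>

section \<open>Traces of \<open>p\<close>-th powers\<close>

text \<open>\<open>\<sigma>\<close> generates an action of the cyclic group of order
  \<open>p\<close> without fixed points. As \<open>p\<close> is prime, every orbit has exactly
  \<open>p\<close> elements, and \<open>g\<close> is constant on it. The induction removes one orbit
  at a time.\<close>

lemma prime_dvd_sum_of_invariant:
  fixes \<sigma> :: "'a \<Rightarrow> 'a" and g :: "'a \<Rightarrow> int"
  assumes p: "Factorial_Ring.prime (p::nat)"
    and "finite \<Omega>"
    and "\<And>x. x \<in> \<Omega> \<Longrightarrow> \<sigma> x \<in> \<Omega>"
    and "\<And>x. x \<in> \<Omega> \<Longrightarrow> (\<sigma> ^^ p) x = x"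
    and "\<And>x. x \<in> \<Omega> \<Longrightarrow> \<sigma> x \<noteq> x"
    and "\<And>x. x \<in> \<Omega> \<Longrightarrow> g (\<sigma> x) = g x"
  shows "int p dvd sum g \<Omega>"
  using assms(2-)
proof (induction \<Omega> rule: finite_psubset_induct)
  case (psubset \<Omega>)
  note clo = psubset.prems(1) and per = psubset.prems(2) and nofix = psubset.prems(3)
    and inv = psubset.prems(4)
  show ?case
  proof (cases "\<Omega> = {}")
    case False
    then obtain x where x: "x \<in> \<Omega>" by blast
    have iter: "(\<sigma> ^^ i) y \<in> \<Omega>" if "y \<in> \<Omega>" for i y
      using that by (induction i) (auto intro: clo)
    have p0: "0 < p" using p prime_gt_0_nat by blast
    define O' where "O' = (\<lambda>i. (\<sigma> ^^ i) x) ` {..<p}"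
    have O'_range: "(\<sigma> ^^ i) x \<in> O'" for i
    proof -
      have "(\<sigma> ^^ i) x = (\<sigma> ^^ (i mod p)) x"
        using funpow_mod_eq[OF per[OF x]] by simp
      then show ?thesis using p0 by (auto simp: O'_def)
    qed
    \<comment> \<open>A period \<open>d\<close> with \<open>0 < d < p\<close> is coprime to
      \<open>p\<close>; by Bezout, \<open>\<sigma>\<close> itself would then fix a point.\<close>
    have inj': "(\<sigma> ^^ i) x \<noteq> (\<sigma> ^^ j) x" if ij: "i < j" "j < p" for i j
    proof
      assume eq: "(\<sigma> ^^ i) x = (\<sigma> ^^ j) x"
      define y where "y = (\<sigma> ^^ i) x"
      define d where "d = j - i"
      have y: "y \<in> \<Omega>" using iter[OF x] y_def by simp
      have "(\<sigma> ^^ (d + i)) x = (\<sigma> ^^ i) x"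
        using eq ij by (simp add: d_def)
      then have dy: "(\<sigma> ^^ d) y = y"
        by (simp add: y_def funpow_add)
      have d: "0 < d" "d < p" using ij by (auto simp: d_def)
      then have "\<not> p dvd d" by (auto dest: dvd_imp_le)
      then have "coprime d p" using p prime_imp_coprime coprime_commute by blast
      then obtain a b where ab: "d * a = p * b + 1"
        using bezout_nat[of d p] d by (metis coprime_imp_gcd_eq_1 neq0_conv)
      have "(\<sigma> ^^ (d * a)) y = y"
        using funpow_mod_eq[OF dy, of "d * a"] by simp
      moreover have "(\<sigma> ^^ (p * b)) y = y"
        using funpow_mod_eq[OF per[OF y], of "p * b"] by simp
      ultimately have "\<sigma> y = y" using ab by simp
      then show False using nofix y by blast
    qed
    have inj: "inj_on (\<lambda>i. (\<sigma> ^^ i) x) {..<p}"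
      using inj' by (intro linorder_inj_onI') auto
    have ginv: "g ((\<sigma> ^^ i) x) = g x" for i
      using iter[OF x] inv by (induction i) auto
    have sumO: "sum g O' = int p * g x"
      unfolding O'_def by (simp add: sum.reindex[OF inj] ginv)
    have sub: "O' \<subseteq> \<Omega>" using iter[OF x] by (auto simp: O'_def)
    have "x \<in> O'" using O'_range[of 0] by simp
    then have ps: "\<Omega> - O' \<subset> \<Omega>" using x by blast
    \<comment> \<open>The inverse of \<open>\<sigma>\<close> on \<open>\<Omega>\<close> is
      \<open>\<sigma> ^^ (p - 1)\<close>, so nothing outside the orbit can be mapped into
      it.\<close>
    have closed: "\<sigma> y \<in> \<Omega> - O'" if y: "y \<in> \<Omega> - O'" for y
    proof -
      have "\<sigma> y \<notin> O'"
      proof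
        assume "\<sigma> y \<in> O'"
        then obtain i where i: "\<sigma> y = (\<sigma> ^^ i) x" by (auto simp: O'_def)
        have "y = (\<sigma> ^^ Suc (p - 1)) y" using per y p0 by simp
        also have "\<dots> = (\<sigma> ^^ (p - 1)) (\<sigma> y)" by (simp add: funpow_swap1)
        also have "\<dots> = (\<sigma> ^^ (p - 1 + i)) x" by (simp add: i funpow_add)
        finally show False using O'_range[of "p - 1 + i"] y by simp
      qed
      then show ?thesis using clo y by blast
    qed
    have "int p dvd sum g (\<Omega> - O')"
      by (rule psubset.IH[OF ps closed]) (auto intro: per inv dest: nofix)
    moreover have "sum g \<Omega> = sum g (\<Omega> - O') + sum g O'"
      using sum.subset_diff[OF sub psubset.hyps] by simp
    ultimately show ?thesis using sumO by simp
  qed simp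
qed

text \<open>Expansion in a noncommutative ring: the order of the factors matters, so the terms are
  indexed by words instead of exponents.\<close>

lemma sum_power_lists:
  fixes x :: "'i \<Rightarrow> 'a::semiring_1"
  assumes "finite S"
  shows "(\<Sum>s\<in>S. x s) ^ n = (\<Sum>l | set l \<subseteq> S \<and> length l = n. prod_list (map x l))"
proof (induction n)
  case 0
  have "{l. set l \<subseteq> S \<and> length l = 0} = {[]}" by auto
  then show ?case by simp
next
  case (Suc n)
  let ?L = "\<lambda>n. {l. set l \<subseteq> S \<and> length l = n}"
  have "(\<Sum>s\<in>S. x s) ^ Suc n = (\<Sum>s\<in>S. \<Sum>l\<in>?L n. x s * prod_list (map x l))"
    by (simp add: Suc sum_distrib_left sum_distrib_right) (rule sum.swap)
  also have "\<dots> = (\<Sum>l\<in>?L n. \<Sum>s\<in>S. x s * prod_list (map x l))"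
    by (rule sum.swap)
  also have "\<dots> = (\<Sum>(l, s)\<in>?L n \<times> S. x s * prod_list (map x l))"
    by (rule sum.cartesian_product)
  also have "\<dots> = (\<Sum>l\<in>?L (Suc n). prod_list (map x l))"
    unfolding lists_length_Suc_eq
    by (subst sum.reindex) (auto simp: inj_split_Cons intro!: sum.cong)
  finally show ?case .
qed

text \<open>If \<open>rotate1\<close> fixes \<open>l\<close>, so do all rotations; the head of the
  rotation by \<open>i\<close> is the entry of index \<open>i\<close>.\<close>

lemma rotate1_fixed_imp_replicate:
  assumes "rotate1 l = l" "l \<noteq> []"
  shows "l = replicate (length l) (hd l)"
proof -
  have "rotate i l = l" for i
    by (induction i) (simp_all add: assms(1))
  then have "l ! i = hd l" if "i < length l" for i
    using that assms(2) hd_rotate_conv_nth[of l i] by simp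
  then show ?thesis
    by (intro nth_equalityI) auto
qed

text \<open>In the expansion into words of length \<open>p\<close>, the value of \<open>T\<close> on
  a word is unchanged by \<open>rotate1\<close>. Words fixed by \<open>rotate1\<close> are constant
  and give the terms \<open>T (x s ^ p)\<close>; the others fall into orbits of length
  \<open>p\<close>.\<close>

lemma trace_of_prime_power:
  fixes T :: "'a::ring_1 \<Rightarrow> int" and x :: "'i \<Rightarrow> 'a"
  assumes p: "Factorial_Ring.prime (p::nat)" and S: "finite S"
    and T0: "T 0 = 0" and Tadd: "\<And>a b. T (a + b) = T a + T b"
    and Tcomm: "\<And>a b. T (a * b) = T (b * a)"
    and pow: "\<And>s. s \<in> S \<Longrightarrow> int p dvd T (x s ^ p)"
  shows "int p dvd T ((\<Sum>s\<in>S. x s) ^ p)"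
proof -
  let ?L = "{l. set l \<subseteq> S \<and> length l = p}"
  define g where "g l = T (prod_list (map x l))" for l
  have p0: "p \<noteq> 0" using p by auto
  have fin: "finite ?L" by (rule finite_lists_length_eq[OF S])
  have "T (\<Sum>l\<in>A. f l) = (\<Sum>l\<in>A. T (f l))" if "finite A" for A and f :: "'i list \<Rightarrow> 'a"
    using that by induction (auto simp: T0 Tadd)
  then have "T ((\<Sum>s\<in>S. x s) ^ p) = sum g ?L"
    by (simp add: sum_power_lists[OF S] g_def fin)
  also have "\<dots> = sum g (?L \<inter> {l. rotate1 l = l}) + sum g (?L - {l. rotate1 l = l})"
    by (rule sum.Int_Diff[OF fin])
  also have "int p dvd \<dots>"
  proof (rule dvd_add)
    show "int p dvd sum g (?L \<inter> {l. rotate1 l = l})"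
    proof (rule dvd_sum)
      fix l assume l: "l \<in> ?L \<inter> {l. rotate1 l = l}"
      with p0 have ne: "l \<noteq> []" by auto
      then have rep: "l = replicate p (hd l)"
        using rotate1_fixed_imp_replicate[of l] l by auto
      have "hd l \<in> S" using ne l by auto
      moreover have "g l = T (x (hd l) ^ p)"
        unfolding g_def by (subst rep) (simp add: prod_list_replicate)
      ultimately show "int p dvd g l" using pow by simp
    qed
    show "int p dvd sum g (?L - {l. rotate1 l = l})"
    proof (rule prime_dvd_sum_of_invariant[OF p, where \<sigma> = rotate1])
      fix l assume l: "l \<in> ?L - {l. rotate1 l = l}"
      show "(rotate1 ^^ p) l = l"
        using l by (simp flip: rotate_def)
      show "g (rotate1 l) = g l"
        unfolding g_def by (cases l) (simp_all add: Tcomm)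
      \<comment> \<open>Injectivity of \<open>rotate1\<close> keeps the set of words that are not
        fixed stable under rotation.\<close>
      have "rotate1 (rotate1 l) \<noteq> rotate1 l"
        using l by (auto dest: injD[OF inj_rotate1])
      then show "rotate1 l \<in> ?L - {l. rotate1 l = l}" using l by simp
    qed (use fin in auto)
  qed
  finally show ?thesis .
qed


section \<open>Monoid algebras\<close>

text \<open>Reduces identities that are additive in \<open>f\<close> to multiples of basis
  elements.\<close>

lemma poly_mapping_additive_induct [case_names zero single add]:
  fixes f :: "'k \<Rightarrow>\<^sub>0 'b::comm_monoid_add"
  assumes "P 0" "\<And>k c. P (Poly_Mapping.single k c)" "\<And>f g. P f \<Longrightarrow> P g \<Longrightarrow> P (f + g)"
  shows "P f"
proof (induction f rule: update_induct)
  case const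
  show ?case by (rule assms(1))
next
  case (update f a b)
  then have "Poly_Mapping.update a b f = f + Poly_Mapping.single a b"
    by (intro poly_mapping_eqI)
      (auto simp: lookup_update lookup_add lookup_single not_in_keys_iff_lookup_eq_zero)
  then show ?case using update assms by simp
qed

lemma poly_mapping_eq_sum_single:
  "f = (\<Sum>k\<in>Poly_Mapping.keys f. Poly_Mapping.single k (Poly_Mapping.lookup f k))"
  by (rule poly_mapping_eqI)
    (simp add: lookup_sum lookup_single when_def sum.delta' in_keys_iff cong: sum.cong)

section \<open>The augmentation as a ring homomorphism\<close>

lemma aug_eq_sum:
  assumes "finite K" "Poly_Mapping.keys s \<subseteq> K"
  shows "aug s = (\<Sum>r\<in>K. of_int (Poly_Mapping.lookup s r) * unMult r)"
  unfolding aug_def using assms by (intro sum.mono_neutral_left) (auto simp: in_keys_iff)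

lemma aug_zero [simp]: "aug 0 = 0"
  by (simp add: aug_def)

lemma aug_single [simp]: "aug (Poly_Mapping.single r c) = of_int c * unMult r"
  by (cases "c = 0") (simp_all add: aug_def)

lemma aug_add: "aug (s + t) = aug s + aug t"
proof -
  let ?K = "Poly_Mapping.keys s \<union> Poly_Mapping.keys t"
  have "aug (s + t) = (\<Sum>r\<in>?K. of_int (Poly_Mapping.lookup (s + t) r) * unMult r)"
    by (rule aug_eq_sum) (simp_all add: Poly_Mapping.keys_add)
  also have "\<dots> = aug s + aug t"
    by (simp add: aug_eq_sum[of ?K s] aug_eq_sum[of ?K t] lookup_add distrib_right sum.distrib)
  finally show ?thesis .
qed

lemma aug_uminus: "aug (- s) = - aug s"
  using aug_add[of s "- s"] by (simp add: eq_neg_iff_add_eq_0 add.commute)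

lemma aug_diff: "aug (s - t) = aug s - aug t"
  using aug_add[of s "- t"] by (simp add: aug_uminus)

lemma aug_mult: "aug (s * t) = aug s * aug t"
proof (induction s rule: poly_mapping_additive_induct)
  case (single k c)
  show ?case
  proof (induction t rule: poly_mapping_additive_induct)
    case (single l d)
    \<comment> \<open>Integers are central in \<open>'a\<close>, although \<open>unMult k\<close>
      and \<open>unMult l\<close> need not commute.\<close>
    have "of_int c * (of_int d * (unMult k * unMult l))
        = of_int c * unMult k * (of_int d * unMult l)"
      by (metis (no_types, lifting) mult.assoc mult_of_int_commute)
    then show ?case by (simp add: mult_single plus_mult_mon_def mult.assoc)
  qed (simp_all add: distrib_left aug_add)
qed (simp_all add: distrib_right aug_add)

lemma aug_one [simp]: "aug 1 = 1"
  by (simp add: zero_mult_mon_def flip: single_one)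

lemma aug_power: "aug (s ^ n) = aug s ^ n"
  by (induction n) (simp_all add: aug_mult)


section \<open>A cyclic word that is not a \<open>p\<close>-th power\<close>

definition rotations :: "'x list \<Rightarrow> 'x list set" where
  "rotations w = range (\<lambda>i. rotate i w)"

lemma finite_rotations [simp]: "finite (rotations w)"
  by (rule finite_subset[OF _ finite_lists_length_eq[of "set w" "length w"]])
    (auto simp: rotations_def)

text \<open>Rotation by the length of the first block exchanges the two blocks. This is what makes
  \<open>cyclic_coeff\<close> a trace.\<close>

lemma rotations_append_commute: "u @ v \<in> rotations w \<longleftrightarrow> v @ u \<in> rotations w"
proof -
  have "b @ a \<in> rotations w" if ab: "a @ b \<in> rotations w" for a b
  proof -
    obtain i where "a @ b = rotate i w" using ab by (auto simp: rotations_def)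
    then have "rotate (length a + i) w = b @ a"
      by (metis rotate_append rotate_rotate)
    then show ?thesis unfolding rotations_def by (metis rangeI)
  qed
  then show ?thesis by blast
qed

lemma inj_rotate: "inj (rotate n)"
  unfolding rotate_def by (rule inj_fn[OF inj_rotate1])

text \<open>The trace \<open>T\<close> attached to the cyclic word of \<open>w\<close>. The sum runs
  over a set, so each conjugate of \<open>w\<close> counts once even if \<open>w\<close> is
  periodic.\<close>

definition cyclic_coeff :: "'x list \<Rightarrow> ('x free_mon \<Rightarrow>\<^sub>0 int) \<Rightarrow> int" where
  "cyclic_coeff w a = (\<Sum>u\<in>rotations w. Poly_Mapping.lookup a (Word u))"

lemma cyclic_coeff_zero [simp]: "cyclic_coeff w 0 = 0"
  by (simp add: cyclic_coeff_def)

lemma cyclic_coeff_add: "cyclic_coeff w (a + b) = cyclic_coeff w a + cyclic_coeff w b"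
  by (simp add: cyclic_coeff_def lookup_add sum.distrib)

lemma cyclic_coeff_uminus: "cyclic_coeff w (- a) = - cyclic_coeff w a"
  by (simp add: cyclic_coeff_def sum_negf)

lemma cyclic_coeff_diff: "cyclic_coeff w (a - b) = cyclic_coeff w a - cyclic_coeff w b"
  by (simp add: cyclic_coeff_def lookup_minus sum_subtractf)

lemma cyclic_coeff_single:
  "cyclic_coeff w (Poly_Mapping.single (Word v) c) = (if v \<in> rotations w then c else 0)"
  by (simp add: cyclic_coeff_def lookup_single when_def sum.delta)

lemma cyclic_coeff_of_nat_mult: "cyclic_coeff w (of_nat n * a) = int n * cyclic_coeff w a"
  by (induction n) (simp_all add: distrib_right cyclic_coeff_add)

text \<open>Both sides are biadditive, so it suffices to compare the products of two monomials,
  whose words are conjugate.\<close>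

lemma cyclic_coeff_mult_commute: "cyclic_coeff w (a * b) = cyclic_coeff w (b * a)"
proof (induction a rule: poly_mapping_additive_induct)
  case (single k c)
  show ?case
  proof (induction b rule: poly_mapping_additive_induct)
    case (single l d)
    show ?case
      by (simp add: mult_single plus_free_mon_def cyclic_coeff_single mult.commute
          rotations_append_commute[of "letters k"])
  qed (simp_all add: distrib_left distrib_right cyclic_coeff_add)
qed (simp_all add: distrib_left distrib_right cyclic_coeff_add)

lemma single_Word_power:
  "Poly_Mapping.single (Word v) c ^ n = Poly_Mapping.single (Word (concat (replicate n v))) (c ^ n)"
  for c :: int
proof (induction n)
  case 0
  show ?case by (simp flip: zero_free_mon_def)
next
  case (Suc n)
  then show ?case by (simp add: mult_single plus_free_mon_def)
qed

text \<open>The trace congruence is applied to the decomposition of \<open>a\<close> into monomials.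
  The \<open>p\<close>-th power of a monomial is a multiple of a word
  \<open>concat (replicate p v)\<close>, on which the trace is 0 by
  \<open>primitive\<close>.\<close>

lemma dvd_cyclic_coeff_power:
  fixes a :: "'x free_mon \<Rightarrow>\<^sub>0 int"
  assumes p: "Factorial_Ring.prime (p::nat)"
    and primitive: "\<And>v. concat (replicate p v) \<notin> rotations w"
  shows "int p dvd cyclic_coeff w (a ^ p)"
proof -
  have "int p dvd cyclic_coeff w
      ((\<Sum>k\<in>Poly_Mapping.keys a. Poly_Mapping.single k (Poly_Mapping.lookup a k)) ^ p)"
  proof (rule trace_of_prime_power[OF p])
    fix k :: "'x free_mon"
    obtain v where "k = Word v" by (cases k)
    then show "int p dvd cyclic_coeff w (Poly_Mapping.single k (Poly_Mapping.lookup a k) ^ p)"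
      using primitive[of v] by (simp add: single_Word_power cyclic_coeff_single)
  qed (simp_all add: cyclic_coeff_add cyclic_coeff_mult_commute)
  then show ?thesis by (simp flip: poly_mapping_eq_sum_single)
qed

text \<open>Comparing lengths leaves only words \<open>v\<close> of length 2, and a
  \<open>p\<close>-th power of such a word has a symmetry that a single block of \<open>x\<close>
  followed by a single block of \<open>y\<close> lacks.\<close>

lemma power_not_in_rotations:
  assumes p: "2 \<le> p" and "x \<noteq> y"
  shows "concat (replicate p v) \<notin> rotations (replicate p x @ replicate p y)"
proof
  let ?w = "replicate p x @ replicate p y"
  assume "concat (replicate p v) \<in> rotations ?w"
  then obtain i where i: "concat (replicate p v) = rotate i ?w"
    by (auto simp: rotations_def)
  have "length (concat (replicate p v)) = length ?w"
    using i by simp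
  then have "p * length v = p * 2"
    by (simp add: length_concat sum_list_replicate)
  then have len: "length v = 2" using p by simp
  txt \<open>Hence \<open>v\<^sup>p\<close>, and with it \<open>x\<^sup>p y\<^sup>p\<close>, is invariant under rotation by 2.\<close>
  obtain q where q: "p = Suc (Suc q)"
    using p by (metis add_2_eq_Suc le_Suc_ex)
  have "concat (replicate p v) = v @ concat (replicate (Suc q) v)"
    by (simp add: q)
  moreover have "v @ concat (replicate (Suc q) v) = concat (replicate (Suc q) v) @ v"
    by (induction q) simp_all
  ultimately have "rotate (length v) (concat (replicate p v)) = concat (replicate p v)"
    using rotate_append by metis
  then have "rotate i (rotate 2 ?w) = rotate i ?w"
    by (simp add: i len rotate_rotate add.commute)
  then have "rotate 2 ?w = ?w"
    by (rule injD[OF inj_rotate])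
  \<comment> \<open>As \<open>p \<ge> 2\<close>, rotation by 2 carries two leading letters
    \<open>x\<close> to the end, whereas \<open>?w\<close> ends in \<open>y\<close>.\<close>
  moreover have "?w = [x, x] @ (replicate q x @ replicate p y)"
    by (simp add: q)
  then have "rotate 2 ?w = (replicate q x @ replicate p y) @ [x, x]"
    using rotate_append[of "[x, x]" "replicate q x @ replicate p y"]
    by (simp only: list.size numeral_2_eq_2 add_0 add_Suc)
  ultimately have "last ?w = x" by (metis append.assoc last_snoc append_Cons append_Nil)
  moreover have "last ?w = y" using p by (simp add: last_replicate)
  ultimately show False using \<open>x \<noteq> y\<close> by simp
qed


section \<open>Closed additive subgroups of sequence spaces\<close>

text \<open>A basic neighbourhood constrains finitely many coordinates, so agreement on initial
  segments describes the product of discrete topologies.\<close>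

lemma closedin_seq_top_iff:
  "closedin seq_top H \<longleftrightarrow> (\<forall>f. (\<forall>n. \<exists>h\<in>H. \<forall>i<n. h i = f i) \<longrightarrow> f \<in> H)"
proof -
  have "openin seq_top (- H) \<longleftrightarrow> (\<forall>f\<in>- H. \<exists>n. \<forall>h. (\<forall>i<n. h i = f i) \<longrightarrow> h \<in> - H)"
  proof
    assume op: "openin seq_top (- H)"
    show "\<forall>f\<in>- H. \<exists>n. \<forall>h. (\<forall>i<n. h i = f i) \<longrightarrow> h \<in> - H"
    proof
      fix f assume "f \<in> - H"
      with op have "\<exists>U. finite {i. U i \<noteq> UNIV} \<and> f \<in> Pi\<^sub>E UNIV U \<and> Pi\<^sub>E UNIV U \<subseteq> - H"
        unfolding seq_top_def openin_product_topology_alt by simp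
      then obtain U where fin: "finite {i. U i \<noteq> UNIV}" and f: "f \<in> Pi\<^sub>E UNIV U"
        and sub: "Pi\<^sub>E UNIV U \<subseteq> - H"
        by blast
      obtain n where n: "\<And>i. U i \<noteq> UNIV \<Longrightarrow> i < n"
        using finite_nat_set_iff_bounded fin by (metis (mono_tags, lifting) mem_Collect_eq)
      have "h \<in> - H" if "\<forall>i<n. h i = f i" for h
      proof -
        have "h i \<in> U i" for i
        proof (cases "U i = UNIV")
          case False
          then show ?thesis using n[of i] that f by auto
        qed simp
        then show ?thesis using sub by auto
      qed
      then show "\<exists>n. \<forall>h. (\<forall>i<n. h i = f i) \<longrightarrow> h \<in> - H" by blast
    qed
  next
    assume R: "\<forall>f\<in>- H. \<exists>n. \<forall>h. (\<forall>i<n. h i = f i) \<longrightarrow> h \<in> - H"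
    show "openin seq_top (- H)"
      unfolding seq_top_def openin_product_topology_alt
    proof
      fix f assume "f \<in> - H"
      then obtain n where n: "\<And>h. (\<forall>i<n. h i = f i) \<Longrightarrow> h \<in> - H" using R by blast
      \<comment> \<open>The cylinder of all sequences that agree with \<open>f\<close> below
        \<open>n\<close>.\<close>
      let ?U = "\<lambda>i. if i < n then {f i} else UNIV"
      have "finite {i. ?U i \<noteq> UNIV}"
        by (rule finite_subset[of _ "{..<n}"]) auto
      moreover have "Pi\<^sub>E UNIV ?U \<subseteq> - H"
      proof
        fix h assume "h \<in> Pi\<^sub>E UNIV ?U"
        then have "h i = f i" if "i < n" for i
          using that PiE_mem[of h UNIV ?U i] by simp
        then show "h \<in> - H" using n by blast
      qed
      ultimately show "\<exists>U. finite {i \<in> UNIV. U i \<noteq> topspace (discrete_topology UNIV)} \<and>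
          (\<forall>i\<in>UNIV. openin (discrete_topology UNIV) (U i)) \<and> f \<in> Pi\<^sub>E UNIV U \<and> Pi\<^sub>E UNIV U \<subseteq> - H"
        by (intro exI[of _ ?U]) auto
    qed
  qed
  moreover have "closedin seq_top H \<longleftrightarrow> openin seq_top (- H)"
    by (simp add: closedin_def seq_top_def Compl_eq_Diff_UNIV)
  ultimately show ?thesis by (metis ComplD ComplI)
qed

section \<open>Additive subgroups of a ring given as a type\<close>

lemma abelian_group_ring_of_type_algebra:
  "abelian_group (ring_of_type_algebra :: 'a::ring_1 ring)"
proof (rule abelian_groupI)
  fix x :: 'a
  show "\<exists>y\<in>carrier ring_of_type_algebra. y \<oplus>\<^bsub>ring_of_type_algebra\<^esub> x = \<zero>\<^bsub>ring_of_type_algebra\<^esub>"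
    by (rule bexI[of _ "- x"]) (simp_all add: ring_of_type_algebra_def)
qed (simp_all add: ring_of_type_algebra_def add.assoc add.commute)

lemma a_inv_ring_of_type_algebra [simp]: "\<ominus>\<^bsub>ring_of_type_algebra\<^esub> x = - x" for x :: "'a::ring_1"
proof -
  interpret abelian_group "ring_of_type_algebra :: 'a ring"
    by (rule abelian_group_ring_of_type_algebra)
  show ?thesis
    by (rule minus_equality) (simp_all add: ring_of_type_algebra_def)
qed

lemma additive_subgroup_type_iff:
  "additive_subgroup H (ring_of_type_algebra :: 'a::ring_1 ring) \<longleftrightarrow>
     0 \<in> H \<and> (\<forall>x\<in>H. \<forall>y\<in>H. x + y \<in> H) \<and> (\<forall>x\<in>H. - x \<in> H)"
  (is "_ \<longleftrightarrow> ?R")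
proof
  assume "additive_subgroup H (ring_of_type_algebra :: 'a ring)"
  then interpret additive_subgroup H "ring_of_type_algebra :: 'a ring" .
  have "- x \<in> H" if "x \<in> H" for x
    unfolding a_inv_ring_of_type_algebra[of x, symmetric] a_inv_def
    by (rule subgroup.m_inv_closed[OF a_subgroup that])
  then show ?R
    using zero_closed a_closed
    by (simp add: ring_of_type_algebra_def)
next
  assume R: ?R
  have "subgroup H (add_monoid (ring_of_type_algebra :: 'a ring))"
  proof (rule subgroup.intro)
    fix x assume "x \<in> H"
    then show "inv\<^bsub>add_monoid ring_of_type_algebra\<^esub> x \<in> H"
      unfolding a_inv_def[symmetric] a_inv_ring_of_type_algebra using R by blast
  qed (use R in \<open>auto simp: ring_of_type_algebra_def\<close>)
  then show "additive_subgroup H (ring_of_type_algebra :: 'a ring)"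
    by (rule additive_subgroupI)
qed

text \<open>The induction principle for X(S): a property is checked on generators, under the group
  operations, and under limits.\<close>

lemma X_set_minimal:
  assumes "X_gens p S \<subseteq> H" "0 \<in> H" "\<And>x y. x \<in> H \<Longrightarrow> y \<in> H \<Longrightarrow> x + y \<in> H"
    and "\<And>x. x \<in> H \<Longrightarrow> - x \<in> H" "\<And>f. (\<And>n. \<exists>h\<in>H. \<forall>i<n. h i = f i) \<Longrightarrow> f \<in> H"
  shows "X_set p S \<subseteq> H"
  unfolding X_set_def
  by (rule Inter_lower) (use assms in \<open>simp add: additive_subgroup_type_iff closedin_seq_top_iff\<close>)

lemma X_gens_subset: "X_gens p S \<subseteq> X_set p S"
  by (auto simp: X_set_def)

lemma X_set_zero: "0 \<in> X_set p S"
  and X_set_add: "x \<in> X_set p S \<Longrightarrow> y \<in> X_set p S \<Longrightarrow> x + y \<in> X_set p S"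
  and X_set_uminus: "x \<in> X_set p S \<Longrightarrow> - x \<in> X_set p S"
  by (auto simp: X_set_def additive_subgroup_type_iff)

lemma X_set_limit:
  assumes "\<And>n. \<exists>h\<in>X_set p S. \<forall>i<n. h i = f i"
  shows "f \<in> X_set p S"
  unfolding X_set_def
proof (rule InterI)
  fix H
  assume H: "H \<in> {H. additive_subgroup H ring_of_type_algebra \<and> closedin seq_top H \<and> X_gens p S \<subseteq> H}"
  then have "X_set p S \<subseteq> H" unfolding X_set_def by (rule Inter_lower)
  then have "\<forall>n. \<exists>h\<in>H. \<forall>i<n. h i = f i" using assms by (meson subsetD)
  moreover have "closedin seq_top H" using H by simp
  ultimately show "f \<in> H" unfolding closedin_seq_top_iff by blast
qed

lemma X_set_diff: "x \<in> X_set p S \<Longrightarrow> y \<in> X_set p S \<Longrightarrow> x - y \<in> X_set p S"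
  using X_set_add[of x p S "- y"] X_set_uminus[of y p S] by simp

lemma X_gens_mono: "S \<subseteq> T \<Longrightarrow> X_gens p S \<subseteq> X_gens p T"
  unfolding X_gens_def by blast

lemma X_set_mono: "S \<subseteq> T \<Longrightarrow> X_set p S \<subseteq> X_set p T"
  by (rule X_set_minimal[OF order.trans[OF X_gens_mono X_gens_subset]])
    (assumption, rule X_set_zero, erule (1) X_set_add, erule X_set_uminus, rule X_set_limit, blast)

lemma X_set_of_nat_mult: "x \<in> X_set p S \<Longrightarrow> of_nat n * x \<in> X_set p S"
  by (induction n) (simp_all add: X_set_zero X_set_add distrib_right)


section \<open>Multiplication on \<open>X(B)\<close>\<close>

text \<open>The Frobenius in ghost coordinates, the partner of the Verschiebung
  \<open>versch\<close>.\<close>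

definition shift :: "(nat \<Rightarrow> 'b) \<Rightarrow> nat \<Rightarrow> 'b" where
  "shift f = (\<lambda>n. f (Suc n))"

lemma shift_mult: "shift (f * g) = shift f * shift g"
  by (simp add: shift_def fun_eq_iff)

text \<open>Frobenius is multiplicative and sends \<open>teich p b\<close> to
  \<open>teich p (b ^ p)\<close>, so it preserves products of Teichmueller elements.\<close>

lemma shift_prod_teich:
  "shift (prod_list (map (teich p) bs)) = prod_list (map (teich p) (map (\<lambda>b. b ^ p) bs))"
proof (induction bs)
  case Nil
  show ?case by (simp add: shift_def fun_eq_iff)
next
  case (Cons b bs)
  have "shift (teich p b) = teich p (b ^ p)"
    by (simp add: shift_def teich_def fun_eq_iff power_mult)
  with Cons show ?case by (simp only: list.map prod_list.Cons shift_mult)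
qed

text \<open>Together with \<open>mult_versch\<close>, the left and right projection formulas for
  Verschiebung and Frobenius.\<close>

lemma versch_mult: "versch p f * g = versch p (f * shift g)"
  by (auto simp: versch_def shift_def fun_eq_iff mult.assoc split: nat.split)

lemma mult_versch: "f * versch p g = versch p (shift f * g)"
  by (auto simp: versch_def shift_def fun_eq_iff split: nat.split)
    (metis mult.assoc mult_of_nat_commute)

lemma shift_versch: "shift (versch p f) = of_nat p * f"
  by (simp add: versch_def shift_def fun_eq_iff of_nat_fun_apply)

lemma versch_of_nat_mult: "versch p (of_nat n * f) = of_nat n * versch p f"
  by (auto simp: versch_def fun_eq_iff of_nat_fun_apply split: nat.split)
    (metis mult.assoc mult_of_nat_commute)

text \<open>With \<open>T\<close> the products of Teichmueller elements, a product of two generators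
  of X(B) is an integer multiple of a generator. The projection formulas pull \<open>versch\<close>
  out, replacing the other factor by its shift; where \<open>versch\<close> occurs on both sides,
  \<open>shift_versch\<close> yields a factor \<open>p\<close>.\<close>

lemma versch_pow_mult:
  assumes T: "\<And>s t. s \<in> T \<Longrightarrow> t \<in> T \<Longrightarrow> s * t \<in> T" "\<And>t. t \<in> T \<Longrightarrow> shift t \<in> T"
  shows "s \<in> T \<Longrightarrow> t \<in> T \<Longrightarrow>
    \<exists>n j. \<exists>u\<in>T. (versch p ^^ m) s * (versch p ^^ k) t = of_nat n * (versch p ^^ j) u"
proof (induction m arbitrary: k s t)
  case 0
  then show ?case
  proof (induction k arbitrary: s)
    case 0
    have "(versch p ^^ 0) s * (versch p ^^ 0) t = of_nat 1 * (versch p ^^ 0) (s * t)"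
      by (simp only: funpow_0 of_nat_1 mult_1_left)
    then show ?case using T(1)[OF 0] by blast
  next
    case (Suc k)
    obtain n j u where u: "u \<in> T"
      and eq: "(versch p ^^ 0) (shift s) * (versch p ^^ k) t = of_nat n * (versch p ^^ j) u"
      using Suc.IH[of "shift s"] Suc.prems T(2) by blast
    have "(versch p ^^ 0) s * (versch p ^^ Suc k) t = of_nat n * (versch p ^^ Suc j) u"
      using eq by (simp add: mult_versch versch_of_nat_mult)
    then show ?case using u by blast
  qed
next
  case (Suc m)
  show ?case
  proof (cases k)
    case 0
    obtain n j u where u: "u \<in> T"
      and eq: "(versch p ^^ m) s * (versch p ^^ 0) (shift t) = of_nat n * (versch p ^^ j) u"
      using Suc.IH[of s "shift t" 0] Suc.prems T(2) by blast
    have "(versch p ^^ Suc m) s * (versch p ^^ k) t = of_nat n * (versch p ^^ Suc j) u"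
      using eq by (simp add: 0 versch_mult versch_of_nat_mult)
    then show ?thesis using u by blast
  next
    case k: (Suc k')
    obtain n j u where u: "u \<in> T"
      and eq: "(versch p ^^ m) s * (versch p ^^ k') t = of_nat n * (versch p ^^ j) u"
      using Suc.IH[of s t k'] Suc.prems by blast
    have "(versch p ^^ Suc m) s * (versch p ^^ k) t
        = versch p (of_nat p * ((versch p ^^ m) s * (versch p ^^ k') t))"
      by (simp add: k versch_mult shift_versch) (metis mult.assoc mult_of_nat_commute)
    also have "\<dots> = of_nat (p * n) * (versch p ^^ Suc j) u"
      by (simp add: eq versch_of_nat_mult mult.assoc)
    finally show ?thesis using u by blast
  qed
qed

text \<open>Generators are multiplied first. Multiplication by a fixed sequence is additive and
  componentwise, so the elements whose product with it lies in X(B) form a closed subgroup;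
  minimality then extends the claim to the right factor and afterwards to the left one.\<close>

lemma X_set_mult:
  fixes f g :: "nat \<Rightarrow> 'a::ring_1"
  assumes "f \<in> X_set p UNIV" "g \<in> X_set p UNIV"
  shows "f * g \<in> X_set p UNIV"
proof -
  define T where "T = {prod_list (map (teich p) bs) | bs :: 'a list. bs \<noteq> []}"
  have gens: "X_gens p UNIV = {(versch p ^^ m) s | m s. s \<in> T}"
    by (auto simp: X_gens_def T_def)
  have T: "s * t \<in> T" if "s \<in> T" "t \<in> T" for s t
  proof -
    from that obtain bs cs where "s = prod_list (map (teich p) bs)"
      "t = prod_list (map (teich p) cs)" "bs \<noteq> []"
      by (auto simp: T_def)
    moreover from this have "prod_list (map (teich p) (bs @ cs)) = s * t" "bs @ cs \<noteq> []"
      by (simp_all only: map_append prod_list.append append_is_Nil_conv simp_thms)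
    ultimately show ?thesis
      unfolding T_def by (metis (mono_tags, lifting) mem_Collect_eq)
  qed
  have T_shift: "shift t \<in> T" if "t \<in> T" for t
  proof -
    from that obtain bs where "t = prod_list (map (teich p) bs)" "bs \<noteq> []"
      by (auto simp: T_def)
    then have "shift t = prod_list (map (teich p) (map (\<lambda>b. b ^ p) bs))"
      "map (\<lambda>b. b ^ p) bs \<noteq> []"
      by (simp_all only: shift_prod_teich map_is_Nil_conv not_False_eq_True)
    then show ?thesis
      unfolding T_def by blast
  qed
  have gen_gen: "s * t \<in> X_set p UNIV" if "s \<in> X_gens p UNIV" "t \<in> X_gens p UNIV"
    for s t :: "nat \<Rightarrow> 'a"
  proof -
    from that obtain m k s' t' where st: "s = (versch p ^^ m) s'" "t = (versch p ^^ k) t'"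
      "s' \<in> T" "t' \<in> T"
      by (auto simp: gens)
    then obtain n j u where "u \<in> T" "s * t = of_nat n * (versch p ^^ j) u"
      using versch_pow_mult[of T s' t' m p k] T T_shift by blast
    moreover from \<open>u \<in> T\<close> have "(versch p ^^ j) u \<in> X_gens p UNIV"
      unfolding gens by blast
    then have "(versch p ^^ j) u \<in> X_set p UNIV"
      by (rule subsetD[OF X_gens_subset])
    ultimately show ?thesis by (simp only: X_set_of_nat_mult)
  qed
  have gen_X: "s * g \<in> X_set p UNIV" if s: "s \<in> X_gens p UNIV" for s :: "nat \<Rightarrow> 'a"
  proof -
    have "X_set p UNIV \<subseteq> {t. s * t \<in> X_set p UNIV}"
    proof (rule X_set_minimal)
      fix t assume lim: "\<And>n. \<exists>h\<in>{t. s * t \<in> X_set p UNIV}. \<forall>i<n. h i = t i"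
      have "\<exists>h\<in>X_set p UNIV. \<forall>i<n. h i = (s * t) i" for n
      proof -
        obtain h where h: "s * h \<in> X_set p UNIV" and eq: "\<forall>i<n. h i = t i"
          using lim[of n] by blast
        from eq have "\<forall>i<n. (s * h) i = (s * t) i" by simp
        then show ?thesis by (rule bexI[where x = "s * h"]) (rule h)
      qed
      from X_set_limit[of p UNIV "s * t", OF this] have "s * t \<in> X_set p UNIV" .
      then show "t \<in> {t. s * t \<in> X_set p UNIV}" by simp
    qed (use gen_gen s in \<open>simp_all add: subset_iff distrib_left X_set_zero X_set_add X_set_uminus\<close>)
    then show ?thesis using assms(2) by blast
  qed
  have "X_set p UNIV \<subseteq> {s. s * g \<in> X_set p UNIV}"
  proof (rule X_set_minimal)
    fix s assume lim: "\<And>n. \<exists>h\<in>{s. s * g \<in> X_set p UNIV}. \<forall>i<n. h i = s i"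
    have "\<exists>h\<in>X_set p UNIV. \<forall>i<n. h i = (s * g) i" for n
    proof -
      obtain h where h: "h * g \<in> X_set p UNIV" and eq: "\<forall>i<n. h i = s i"
        using lim[of n] by blast
      from eq have "\<forall>i<n. (h * g) i = (s * g) i" by simp
      then show ?thesis by (rule bexI[where x = "h * g"]) (rule h)
    qed
    from X_set_limit[of p UNIV "s * g", OF this] have "s * g \<in> X_set p UNIV" .
    then show "s \<in> {s. s * g \<in> X_set p UNIV}" by simp
  qed (use gen_X in \<open>simp_all add: subset_iff distrib_right X_set_zero X_set_add X_set_uminus\<close>)
  then show ?thesis using assms(1) by blast
qed


section \<open>Commutator quotients\<close>

lemma comm_subgroup_type_eq:
  "comm_subgroup (ring_of_type_algebra :: 'a::ring_1 ring) =
     generate (add_monoid ring_of_type_algebra) {x * y - y * x | x y. True}"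
proof -
  have "x \<otimes>\<^bsub>ring_of_type_algebra\<^esub> y \<ominus>\<^bsub>ring_of_type_algebra\<^esub> y \<otimes>\<^bsub>ring_of_type_algebra\<^esub> x = x * y - y * x"
    for x y :: 'a
    unfolding a_minus_def a_inv_ring_of_type_algebra by (simp add: ring_of_type_algebra_def)
  then show ?thesis
    unfolding comm_subgroup_def by (simp add: ring_of_type_algebra_def)
qed

lemma comm_subgroup_minimal:
  fixes H :: "'a::ring_1 set"
  assumes "0 \<in> H" "\<And>x y. x \<in> H \<Longrightarrow> y \<in> H \<Longrightarrow> x + y \<in> H" "\<And>x. x \<in> H \<Longrightarrow> - x \<in> H"
    and "\<And>x y. x * y - y * x \<in> H"
  shows "comm_subgroup ring_of_type_algebra \<subseteq> H"
proof -
  have "additive_subgroup H ring_of_type_algebra"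
    using assms by (simp add: additive_subgroup_type_iff)
  then have "subgroup H (add_monoid ring_of_type_algebra)"
    by (rule additive_subgroup.a_subgroup)
  then show ?thesis
    unfolding comm_subgroup_type_eq
    by (rule group.generate_subgroup_incl[OF abelian_group.a_group[OF
          abelian_group_ring_of_type_algebra], rotated]) (use assms(4) in blast)
qed

lemma comm_subgroup_closed:
  fixes C :: "'a::ring_1 set"
  defines "C \<equiv> comm_subgroup ring_of_type_algebra"
  shows "0 \<in> C" "x \<in> C \<Longrightarrow> y \<in> C \<Longrightarrow> x + y \<in> C" "x \<in> C \<Longrightarrow> - x \<in> C"
    and "x * y - y * x \<in> C"
proof -
  have "subgroup C (add_monoid ring_of_type_algebra)"
    unfolding C_def comm_subgroup_type_eq
    by (rule group.generate_is_subgroup[OF abelian_group.a_group[OF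
          abelian_group_ring_of_type_algebra]]) (simp add: ring_of_type_algebra_def)
  then have "additive_subgroup C ring_of_type_algebra"
    by (rule additive_subgroupI)
  then show "0 \<in> C" "x \<in> C \<Longrightarrow> y \<in> C \<Longrightarrow> x + y \<in> C" "x \<in> C \<Longrightarrow> - x \<in> C"
    by (simp_all add: additive_subgroup_type_iff)
  show "x * y - y * x \<in> C"
    unfolding C_def comm_subgroup_type_eq by (rule generate.incl) blast
qed

lemma ab_class_eq: "ab_class a = (\<lambda>c. c + a) ` comm_subgroup ring_of_type_algebra"
  by (auto simp: ab_class_def a_r_coset_defs ring_of_type_algebra_def)

lemma ab_class_add_comm:
  assumes "c \<in> comm_subgroup ring_of_type_algebra"
  shows "ab_class (c + a) = ab_class a"
proof -
  have "d + (c + a) \<in> ab_class a" if "d \<in> comm_subgroup ring_of_type_algebra" for d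
    unfolding ab_class_eq add.assoc[symmetric]
    using comm_subgroup_closed(2)[OF that assms] by blast
  moreover have "d + a \<in> ab_class (c + a)" if "d \<in> comm_subgroup ring_of_type_algebra" for d
  proof -
    have "d + - c \<in> comm_subgroup ring_of_type_algebra"
      using that assms comm_subgroup_closed(2,3) by blast
    moreover have "d + a = (d + - c) + (c + a)" by simp
    ultimately show ?thesis unfolding ab_class_eq by blast
  qed
  ultimately show ?thesis unfolding ab_class_eq[of a] ab_class_eq[of "c + a"] by blast
qed

lemma ab_class_eq_imp_diff:
  assumes "ab_class a = ab_class b"
  shows "a - b \<in> comm_subgroup ring_of_type_algebra"
proof -
  have "0 + a \<in> ab_class a"
    unfolding ab_class_eq using comm_subgroup_closed(1) by blast
  then have "a \<in> (\<lambda>c. c + b) ` comm_subgroup ring_of_type_algebra"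
    using assms by (simp add: ab_class_eq)
  then show ?thesis by auto
qed

text \<open>The kernel of a trace is a subgroup containing all commutators, so
  \<open>cyclic_coeff\<close> descends to A/[A,A].\<close>

lemma cyclic_coeff_eq_if_ab_class_eq:
  assumes "ab_class a = ab_class b"
  shows "cyclic_coeff w a = cyclic_coeff w b"
proof -
  have "comm_subgroup ring_of_type_algebra \<subseteq> {a. cyclic_coeff w a = 0}"
    by (rule comm_subgroup_minimal)
      (simp_all add: cyclic_coeff_add cyclic_coeff_uminus cyclic_coeff_diff
        cyclic_coeff_mult_commute)
  with ab_class_eq_imp_diff[OF assms] show ?thesis
    by (auto simp: cyclic_coeff_diff)
qed


section \<open>The additive group of \<open>E(A)\<close>\<close>

lemma X_ring_simps [simp]:
  "carrier (X_ring p) = X_set p UNIV" "x \<oplus>\<^bsub>X_ring p\<^esub> y = x + y" "\<zero>\<^bsub>X_ring p\<^esub> = 0"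
  by (simp_all add: X_ring_def ring_of_type_algebra_def)

lemma abelian_group_X_ring: "abelian_group (X_ring p)"
proof (rule abelian_groupI)
  fix x assume "x \<in> carrier (X_ring p)"
  then show "\<exists>y\<in>carrier (X_ring p). y \<oplus>\<^bsub>X_ring p\<^esub> x = \<zero>\<^bsub>X_ring p\<^esub>"
    using X_set_uminus[of x p UNIV] by (intro bexI[where x = "- x"]) simp_all
qed (simp_all add: X_set_zero X_set_add add.assoc add.commute)

lemma a_inv_X_ring: "x \<in> X_set p UNIV \<Longrightarrow> \<ominus>\<^bsub>X_ring p\<^esub> x = - x"
  by (rule abelian_group.minus_equality[OF abelian_group_X_ring]) (simp_all add: X_set_uminus)

text \<open>For \<open>S = aug_ideal\<close> this makes the cosets of X(I) an additive group, that
  of E(A).\<close>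

lemma abelian_subgroup_X_set: "abelian_subgroup (X_set p S) (X_ring p)"
proof (rule abelian_subgroupI3[OF additive_subgroupI abelian_group_X_ring])
  have sub: "X_set p S \<subseteq> X_set p UNIV" by (rule X_set_mono) simp
  show "subgroup (X_set p S) (add_monoid (X_ring p))"
  proof (rule subgroup.intro)
    fix x assume x: "x \<in> X_set p S"
    then have "x \<in> X_set p UNIV" using sub by blast
    then show "inv\<^bsub>add_monoid (X_ring p)\<^esub> x \<in> X_set p S"
      unfolding a_inv_def[symmetric] using x X_set_uminus[of x p S] by (simp add: a_inv_X_ring)
  qed (use sub in \<open>simp_all add: X_set_zero X_set_add\<close>)
qed

lemma E_class_eq: "E_class p f = (\<lambda>h. h + f) ` X_set p aug_ideal"
  by (auto simp: E_class_def a_r_coset_defs)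

lemma carrier_E_ring: "carrier (E_ring p) = E_class p ` X_set p UNIV"
  by (auto simp: E_ring_def FactRing_def A_RCOSETS_def' E_class_def)

lemma E_class_add:
  assumes "f \<in> X_set p UNIV" "g \<in> X_set p UNIV"
  shows "E_class p f \<oplus>\<^bsub>E_ring p\<^esub> E_class p g = E_class p (f + g)"
  using abelian_subgroup.a_rcos_sum[OF abelian_subgroup_X_set, of f p g] assms
  by (simp add: E_ring_def FactRing_def E_class_def)

lemma zero_E_ring: "\<zero>\<^bsub>E_ring p\<^esub> = E_class p 0"
  by (simp add: E_ring_def FactRing_def E_class_eq)

lemma group_E_ring: "group (add_monoid (E_ring p))"
  using abelian_subgroup.a_factorgroup_is_group[OF abelian_subgroup_X_set, of p aug_ideal]
  by (simp add: E_ring_def FactRing_def A_FactGroup_def')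

lemma inv_E_class:
  assumes "f \<in> X_set p UNIV"
  shows "inv\<^bsub>add_monoid (E_ring p)\<^esub> (E_class p f) = E_class p (- f)"
proof (rule group.inv_equality[OF group_E_ring])
  show "E_class p (- f) \<otimes>\<^bsub>add_monoid (E_ring p)\<^esub> E_class p f = \<one>\<^bsub>add_monoid (E_ring p)\<^esub>"
    using E_class_add[of "- f" p f] assms X_set_uminus[of f p UNIV] by (simp add: zero_E_ring)
qed (use assms X_set_uminus[of f p UNIV] in \<open>simp_all add: carrier_E_ring\<close>)


section \<open>The ghost map of \<open>HH\<^sub>0(E(A))\<close>\<close>

text \<open>Each component of a product of Teichmueller elements over I has a factor in I,
  Verschiebung preserves the vanishing of \<open>aug\<close>, and this vanishing is a closed
  condition.\<close>

lemma aug_X_set_aug_ideal: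
  assumes "p \<noteq> 0" and f: "f \<in> X_set p aug_ideal"
  shows "aug (f n) = 0"
proof -
  \<comment> \<open>A first factor exists because \<open>bs \<noteq> []\<close>; its exponent
    \<open>p ^ n\<close> is positive because \<open>p \<noteq> 0\<close>, which excludes
    \<open>0 ^ 0 = 1\<close>.\<close>
  have teich: "aug (prod_list (map (teich p) bs) n) = 0"
    if "bs \<noteq> []" "set bs \<subseteq> aug_ideal" for bs :: "'a mon_alg list" and n
    using that assms(1)
    by (cases bs) (simp_all add: aug_mult teich_def aug_power aug_ideal_def power_0_left)
  have versch: "\<forall>n. aug ((versch p ^^ m) g n) = 0" if "\<forall>n. aug (g n) = 0"
    for m and g :: "nat \<Rightarrow> 'a mon_alg"
    using that by (induction m) (auto simp: versch_def aug_mult split: nat.split)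
  have "X_set p aug_ideal \<subseteq> {f :: nat \<Rightarrow> 'a mon_alg. \<forall>n. aug (f n) = 0}"
  proof (rule X_set_minimal)
    show "X_gens p aug_ideal \<subseteq> {f :: nat \<Rightarrow> 'a mon_alg. \<forall>n. aug (f n) = 0}"
      unfolding X_gens_def using teich versch by blast
  next
    fix f :: "nat \<Rightarrow> 'a mon_alg"
    assume lim: "\<And>n. \<exists>h\<in>{f. \<forall>n. aug (f n) = 0}. \<forall>i<n. h i = f i"
    have "aug (f n) = 0" for n
      using lim[of "Suc n"] by (metis (mono_tags) lessI mem_Collect_eq)
    then show "f \<in> {f. \<forall>n. aug (f n) = 0}" by simp
  qed (simp_all add: aug_add aug_uminus)
  with f show ?thesis by blast
qed

text \<open>Representatives of a coset differ by an element of X(I), which \<open>aug\<close> kills,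
  so \<open>the_elem\<close> is applied to a singleton.\<close>

lemma pi_E_class:
  assumes "p \<noteq> 0"
  shows "pi_E (E_class p f) = (\<lambda>n. aug (f n))"
proof -
  have "(\<lambda>f n. aug (f n)) ` E_class p f = {\<lambda>n. aug (f n)}"
  proof
    show "(\<lambda>f n. aug (f n)) ` E_class p f \<subseteq> {\<lambda>n. aug (f n)}"
      by (auto simp: E_class_eq aug_add aug_X_set_aug_ideal[OF assms])
    have "0 + f \<in> E_class p f"
      unfolding E_class_eq using X_set_zero by blast
    then show "{\<lambda>n. aug (f n)} \<subseteq> (\<lambda>f n. aug (f n)) ` E_class p f" by simp
  qed
  then show ?thesis by (simp add: pi_E_def)
qed

text \<open>The kernel of \<open>eta\<close>. Being a closed subgroup that contains
  \<open>E_comm p\<close>, it also contains the closure by which \<open>HH0_E p\<close>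
  divides.\<close>

definition ghost_kernel :: "nat \<Rightarrow> (nat \<Rightarrow> 'a::ring_1 mon_alg) set set" where
  "ghost_kernel p = {c \<in> carrier (E_ring p). \<forall>n. pi_E c n \<in> comm_subgroup ring_of_type_algebra}"

lemma E_class_in_ghost_kernel:
  assumes "p \<noteq> 0" "f \<in> X_set p UNIV"
  shows "E_class p f \<in> ghost_kernel p \<longleftrightarrow> (\<forall>n. aug (f n) \<in> comm_subgroup ring_of_type_algebra)"
  using assms by (simp add: ghost_kernel_def carrier_E_ring pi_E_class)

lemma ghost_kernel_cases:
  assumes "p \<noteq> 0" "c \<in> ghost_kernel p"
  obtains f where "f \<in> X_set p UNIV" "c = E_class p f"
    "\<And>n. aug (f n) \<in> comm_subgroup ring_of_type_algebra"
proof -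
  from assms(2) obtain f where f: "f \<in> X_set p UNIV" "c = E_class p f"
    by (auto simp: ghost_kernel_def carrier_E_ring)
  then show ?thesis using that assms E_class_in_ghost_kernel by blast
qed

text \<open>As a ring homomorphism, \<open>aug\<close> sends each component of
  \<open>f * g - g * f\<close> to a commutator; \<open>X_set_mult\<close> keeps this representative
  inside X(B) for B the monoid algebra.\<close>

lemma E_comm_subset_ghost_kernel:
  assumes "p \<noteq> 0"
  shows "E_comm p \<subseteq> (ghost_kernel p :: (nat \<Rightarrow> 'a::ring_1 mon_alg) set set)"
  unfolding E_comm_def
proof (rule group.generate_subgroup_incl[OF group_E_ring])
  show "{E_class p (f * g - g * f) | f g :: nat \<Rightarrow> 'a mon_alg.
      f \<in> X_set p UNIV \<and> g \<in> X_set p UNIV} \<subseteq> ghost_kernel p"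
  proof (intro subsetI, elim CollectE exE conjE)
    fix c and f g :: "nat \<Rightarrow> 'a mon_alg"
    assume c: "c = E_class p (f * g - g * f)"
      and fg: "f \<in> X_set p UNIV" "g \<in> X_set p UNIV"
    have "f * g - g * f \<in> X_set p UNIV"
      using fg by (intro X_set_diff X_set_mult)
    moreover have "aug ((f * g - g * f) n) \<in> comm_subgroup ring_of_type_algebra" for n
      using comm_subgroup_closed(4) by (simp add: aug_diff aug_mult)
    ultimately show "c \<in> ghost_kernel p"
      unfolding c using E_class_in_ghost_kernel[OF assms] by blast
  qed
  show "subgroup (ghost_kernel p :: (nat \<Rightarrow> 'a mon_alg) set set) (add_monoid (E_ring p))"
  proof (rule subgroup.intro)
    fix c d :: "(nat \<Rightarrow> 'a mon_alg) set"
    assume c: "c \<in> ghost_kernel p" and d: "d \<in> ghost_kernel p"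
    obtain f where f: "f \<in> X_set p UNIV" "c = E_class p f"
      "\<And>n. aug (f n) \<in> comm_subgroup ring_of_type_algebra"
      using ghost_kernel_cases[OF assms c] by blast
    obtain g where g: "g \<in> X_set p UNIV" "d = E_class p g"
      "\<And>n. aug (g n) \<in> comm_subgroup ring_of_type_algebra"
      using ghost_kernel_cases[OF assms d] by blast
    have "aug ((f + g) n) \<in> comm_subgroup ring_of_type_algebra" for n
      using comm_subgroup_closed(2)[OF f(3) g(3)] by (simp add: aug_add)
    then have "E_class p (f + g) \<in> ghost_kernel p"
      using E_class_in_ghost_kernel[OF assms X_set_add[OF f(1) g(1)]] by blast
    then show "c \<otimes>\<^bsub>add_monoid (E_ring p)\<^esub> d \<in> ghost_kernel p"
      using E_class_add[OF f(1) g(1)] by (simp add: f(2) g(2))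
  next
    fix c :: "(nat \<Rightarrow> 'a mon_alg) set"
    assume c: "c \<in> ghost_kernel p"
    obtain f where f: "f \<in> X_set p UNIV" "c = E_class p f"
      "\<And>n. aug (f n) \<in> comm_subgroup ring_of_type_algebra"
      using ghost_kernel_cases[OF assms c] by blast
    have "aug ((- f) n) \<in> comm_subgroup ring_of_type_algebra" for n
      using comm_subgroup_closed(3)[OF f(3)] by (simp add: aug_uminus)
    then show "inv\<^bsub>add_monoid (E_ring p)\<^esub> c \<in> ghost_kernel p"
      using E_class_in_ghost_kernel[OF assms X_set_uminus[OF f(1)]] f(2) inv_E_class[OF f(1)]
      by simp
  next
    show "\<one>\<^bsub>add_monoid (E_ring p)\<^esub> \<in> (ghost_kernel p :: (nat \<Rightarrow> 'a mon_alg) set set)"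
      by (simp add: zero_E_ring E_class_in_ghost_kernel[OF assms X_set_zero] comm_subgroup_closed(1))
  qed (auto simp: ghost_kernel_def)
qed

section \<open>The closure of the commutators and the ghost map on its cosets\<close>

lemma topspace_E_top:
  "topspace (E_top p) = (carrier (E_ring p) :: (nat \<Rightarrow> 'a::ring_1 mon_alg) set set)" (is "_ = ?E")
proof
  show "topspace (E_top p) \<subseteq> ?E"
    using openin_topspace[of "E_top p"] unfolding openin_E_top by blast
  have "{f \<in> X_set p UNIV. E_class p f \<in> ?E} = X_set p UNIV"
    by (auto simp: carrier_E_ring)
  moreover have "openin (subtopology seq_top (X_set p UNIV)) (X_set p (UNIV :: 'a mon_alg set))"
    by (simp add: openin_subtopology_refl seq_top_def)
  ultimately have "openin (E_top p) ?E"
    by (simp add: openin_E_top)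
  then show "?E \<subseteq> topspace (E_top p)"
    by (rule openin_subset)
qed

text \<open>Its preimage among the sequences is cut out by conditions on single components, hence
  closed in the product topology; complements transfer this to the quotient topology.\<close>

lemma closedin_ghost_kernel:
  fixes p :: nat
  assumes "p \<noteq> 0"
  shows "closedin (E_top p) (ghost_kernel p :: (nat \<Rightarrow> 'a::ring_1 mon_alg) set set)"
proof -
  let ?C = "comm_subgroup (ring_of_type_algebra :: 'a ring)"
  let ?H = "{f :: nat \<Rightarrow> 'a mon_alg. \<forall>n. aug (f n) \<in> ?C}"
  have "f \<in> ?H" if lim: "\<forall>n. \<exists>h\<in>?H. \<forall>i<n. h i = f i" for f
  proof -
    have "aug (f n) \<in> ?C" for n
      using lim[rule_format, of "Suc n"] by (metis (mono_tags, lifting) lessI mem_Collect_eq)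
    then show ?thesis by simp
  qed
  then have "closedin seq_top ?H"
    unfolding closedin_seq_top_iff by blast
  then have "openin (subtopology seq_top (X_set p UNIV)) ((topspace seq_top - ?H) \<inter> X_set p UNIV)"
    by (intro openin_subtopology_Int) (simp add: closedin_def)
  moreover have "{f \<in> X_set p UNIV. E_class p f \<in> carrier (E_ring p) - ghost_kernel p}
      = (topspace seq_top - ?H) \<inter> X_set p UNIV"
    using E_class_in_ghost_kernel[OF assms, where 'a = 'a]
    by (auto simp: carrier_E_ring seq_top_def)
  ultimately have "openin (E_top p) (carrier (E_ring p) - (ghost_kernel p :: (nat \<Rightarrow> 'a mon_alg) set set))"
    by (simp add: openin_E_top)
  then show ?thesis
    by (auto simp: closedin_def topspace_E_top ghost_kernel_def)
qed

text \<open>Elements of the coset differ from \<open>E_class p f\<close> by members of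
  \<open>ghost_kernel p\<close>, so \<open>eta\<close> is constant on it with the value at
  \<open>f\<close>.\<close>

lemma HH0_E_element:
  fixes f :: "nat \<Rightarrow> 'a::ring_1 mon_alg"
  assumes "p \<noteq> 0" "f \<in> X_set p UNIV"
  shows "\<exists>x\<in>carrier (HH0_E p). eta_bar x = (\<lambda>n. ab_class (aug (f n)))"
proof
  let ?N = "E_top p closure_of E_comm p :: (nat \<Rightarrow> 'a mon_alg) set set"
  let ?x = "?N #>\<^bsub>add_monoid (E_ring p)\<^esub> E_class p f"
  show "?x \<in> carrier (HH0_E p)"
    unfolding HH0_E_def FactGroup_def RCOSETS_def using assms(2) by (auto simp: carrier_E_ring)
  have N: "?N \<subseteq> ghost_kernel p"
    by (intro closure_of_minimal E_comm_subset_ghost_kernel closedin_ghost_kernel assms)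
  \<comment> \<open>This shows \<open>?N\<close> to be nonempty; otherwise the image of the coset
    would be empty and \<open>the_elem\<close> would say nothing.\<close>
  have "E_comm p \<subseteq> ?N"
    using E_comm_subset_ghost_kernel[OF assms(1), where 'a = 'a]
    by (intro closure_of_subset) (auto simp: topspace_E_top ghost_kernel_def)
  moreover have "\<one>\<^bsub>add_monoid (E_ring p)\<^esub> \<in> (E_comm p :: (nat \<Rightarrow> 'a mon_alg) set set)"
    unfolding E_comm_def by (rule generate.one)
  ultimately have ne: "?N \<noteq> {}" by blast
  have "eta (c \<oplus>\<^bsub>E_ring p\<^esub> E_class p f) = (\<lambda>n. ab_class (aug (f n)))" if c: "c \<in> ?N" for c
  proof -
    from c N have ck: "c \<in> ghost_kernel p" by blast
    obtain g where g: "g \<in> X_set p UNIV" "c = E_class p g"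
      "\<And>n. aug (g n) \<in> comm_subgroup ring_of_type_algebra"
      using ghost_kernel_cases[OF assms(1) ck] by blast
    show ?thesis
      using E_class_add[OF g(1) assms(2)] ab_class_add_comm[OF g(3)]
      by (simp add: g(2) eta_def gamma_def pi_E_class[OF assms(1)] aug_add)
  qed
  then have "eta ` ?x = {\<lambda>n. ab_class (aug (f n))}"
    using ne unfolding r_coset_def by (auto simp: image_UN)
  then show "eta_bar ?x = (\<lambda>n. ab_class (aug (f n)))"
    by (simp add: eta_bar_def)
qed

section \<open>Comparison of the two ghost maps\<close>

lemma omega_bar_W_group:
  assumes "w \<in> carrier (W_group p)"
  shows "\<exists>a. omega_bar w i = ab_class (witt_poly p i a)"
proof -
  \<comment> \<open>The carrier of this truncation is an image of \<open>omega\<close>; the sequence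
    \<open>a\<close> found there may depend on \<open>i\<close>.\<close>
  have "w (Suc i) \<in> carrier (W_trunc p (Suc i))"
    using assms by (auto simp: W_group_def)
  then obtain a where "w (Suc i) = omega p (Suc i) a"
    by (auto simp: W_trunc_def)
  then show ?thesis
    by (auto simp: omega_bar_def omega_def)
qed

theorem theorem1p2:
  fixes p :: nat
  assumes "Factorial_Ring.prime p"
  shows "\<not> (\<exists>\<rho> :: (nat \<Rightarrow> ZXY mon_alg) set set \<Rightarrow> (nat \<Rightarrow> nat \<Rightarrow> ZXY set).
            \<rho> \<in> carrier (HH0_E p) \<rightarrow> carrier (W_group p) \<and>
            (\<forall>x \<in> carrier (HH0_E p). omega_bar (\<rho> x) = eta_bar x))"
proof
  assume "\<exists>\<rho> :: (nat \<Rightarrow> ZXY mon_alg) set set \<Rightarrow> (nat \<Rightarrow> nat \<Rightarrow> ZXY set).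
            \<rho> \<in> carrier (HH0_E p) \<rightarrow> carrier (W_group p) \<and>
            (\<forall>x \<in> carrier (HH0_E p). omega_bar (\<rho> x) = eta_bar x)"
  then obtain \<rho> :: "(nat \<Rightarrow> ZXY mon_alg) set set \<Rightarrow> (nat \<Rightarrow> nat \<Rightarrow> ZXY set)"
    where \<rho>: "\<And>x. x \<in> carrier (HH0_E p) \<Longrightarrow> \<rho> x \<in> carrier (W_group p)"
      and ghost: "\<And>x. x \<in> carrier (HH0_E p) \<Longrightarrow> omega_bar (\<rho> x) = eta_bar x"
    by blast
  have p: "p \<noteq> 0" "2 \<le> p" using assms prime_ge_2_nat[OF assms] by auto
  define x :: "letter \<Rightarrow> ZXY" where "x l = Poly_Mapping.single (Word [l]) 1" for l
  \<comment> \<open>The basis elements [X] and [Y] of the monoid algebra, lifting the generators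
    \<open>x LX\<close> and \<open>x LY\<close> along \<open>aug\<close>.\<close>
  define b :: "letter \<Rightarrow> ZXY mon_alg" where "b l = Poly_Mapping.single (Mult (x l)) 1" for l
  define f where "f = prod_list (map (teich p) [b LX, b LY])"
  let ?w = "replicate p LX @ replicate p LY"
  have "(versch p ^^ 0) f \<in> X_gens p UNIV"
    unfolding X_gens_def f_def by blast
  then have "f \<in> X_set p UNIV"
    using X_gens_subset[of p UNIV] by auto
  then obtain c where c: "c \<in> carrier (HH0_E p)" "eta_bar c = (\<lambda>n. ab_class (aug (f n)))"
    using HH0_E_element[OF p(1)] by blast
  \<comment> \<open>Index 1 is the first that can obstruct: at index 0 the Witt polynomial is
    \<open>a 0\<close>, which is arbitrary.\<close>
  obtain a where a: "omega_bar (\<rho> c) 1 = ab_class (witt_poly p 1 a)"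
    using omega_bar_W_group[OF \<rho>[OF c(1)]] by blast
  have "aug (f 1) = x LX ^ p * x LY ^ p"
    by (simp add: f_def teich_def aug_mult aug_power b_def)
  also have "\<dots> = Poly_Mapping.single (Word ?w) 1"
    by (simp add: x_def single_Word_power mult_single plus_free_mon_def concat_replicate_single)
  finally have "ab_class (Poly_Mapping.single (Word ?w) 1) = ab_class (witt_poly p 1 a)"
    using a ghost[OF c(1)] c(2) by simp
  then have "cyclic_coeff ?w (Poly_Mapping.single (Word ?w) 1) = cyclic_coeff ?w (witt_poly p 1 a)"
    by (rule cyclic_coeff_eq_if_ab_class_eq)
  moreover have "?w \<in> rotations ?w"
    unfolding rotations_def by (rule range_eqI[of _ _ 0]) simp
  moreover have "witt_poly p 1 a = a 0 ^ p + of_nat p * a 1"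
    by (simp add: witt_poly_def)
  \<comment> \<open>The word \<open>?w\<close> has trace 1, whereas both terms on the right are
    divisible by \<open>p\<close>.\<close>
  ultimately have "1 = cyclic_coeff ?w (a 0 ^ p) + int p * cyclic_coeff ?w (a 1)"
    by (simp add: cyclic_coeff_single cyclic_coeff_add cyclic_coeff_of_nat_mult)
  moreover have "int p dvd cyclic_coeff ?w (a 0 ^ p)"
    by (rule dvd_cyclic_coeff_power[OF assms power_not_in_rotations[OF p(2)]]) simp
  ultimately have "int p dvd 1"
    by (metis dvd_add dvd_triv_left)
  then show False using p by simp
qed

end
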